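(* Let $\delta\in\left(0,\frac12\right)$, $0<\sigma\le\frac12$, $t>0$, $s=\sigma+it$, and define $$S_2(\sigma,t,\delta)=\sum_{m_1=[t^{1-\delta}]}^{[t]}\ \sum_{m_2=1}^{\left[\frac{m_1}{t^{1-\delta}}\right]}\frac{1}{m_1^{s}(m_1+m_2)^{\bar s}}.$$ Then, as $t\to\infty$, $$S_2(\sigma,t,\delta)=\begin{cases}O\left(t^{1-2\sigma}\right)+O\left(t^{\delta-2\sigma}\right), & 0<\sigma<\frac12,\\[1mm] O(\ln t)+O\left(t^{\delta-1}\right), & \sigma=\frac12.\end{cases}$$
   Context: $[A]$ denotes the integer part of $A$, and $\bar s=\sigma-it$ is the complex conjugate of $s$. Sums over empty ranges are zero. The parameters $\sigma,\delta$ are fixed, and the $O$-statements are for real $t\to\infty$ (implied constants may depend on $\sigma,\delta$). *)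

theory Defs
  imports "HOL-Analysis.Analysis" "HOL-Library.Landau_Symbols"
begin

definition S2 :: "real \<Rightarrow> real \<Rightarrow> real \<Rightarrow> complex" where
  "S2 \<sigma> t \<delta> =
     (let s = Complex \<sigma> t in
      \<Sum>m1 = nat \<lfloor>t powr (1 - \<delta>)\<rfloor>..nat \<lfloor>t\<rfloor>.
        \<Sum>m2 = 1..nat \<lfloor>real m1 / t powr (1 - \<delta>)\<rfloor>.
          1 / (of_nat m1 powr s * of_nat (m1 + m2) powr (cnj s)))"

end

theory Submission imports Defs begin

text \<open>
  In fact the sum is \<open>O(t powr (1 - 2 * \<sigma>))\<close>, so the second error term can be taken to be zero.
  Put \<open>T = t powr (1 - \<delta>)\<close> and exchange the summations. For fixed \<open>k = m\<^sub>2\<close> the summand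
  \<open>g x = x powr (-s) * (x + k) powr (- cnj s)\<close>, for \<open>k * T \<le> x \<le> t\<close>, has a phase whose derivative is
  of size \<open>t * k / x\<^sup>2 < 1\<close>, and \<open>g\<close> has an explicit approximate antiderivative \<open>H\<close>, exact up to a
  relative error \<open>O((x / (t * k))\<^sup>2)\<close>. The first-order antiderivative would only give a relative error
  \<open>O(x / (t * k))\<close>, whose sum over \<open>k\<close> loses a logarithm. Replacing \<open>g m\<close> by \<open>H (m + 1) - H m\<close>
  leaves errors that are acceptable because \<open>\<delta> < 1/2\<close>, and two endpoint terms. The lower one, at
  \<open>x \<approx> k * T\<close>, can be summed over \<open>k\<close> trivially. The upper one, at \<open>x \<approx> t\<close>, behaves like
  \<open>t powr (1 - 2 * \<sigma>) * exp (\<i> * k) / k\<close>, and its sum over \<open>k\<close> is bounded by partial summation,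
  since \<open>exp \<i> \<noteq> 1\<close>.
\<close>

section \<open>The summand and its approximate antiderivative\<close>

text \<open>The summand at \<open>m1 = z\<close>, \<open>m2 = k\<close>, taken at complex
  \<open>z\<close> so that field derivatives apply; the estimates concern positive real
  \<open>z\<close> only.\<close>

definition osc :: "real \<Rightarrow> real \<Rightarrow> nat \<Rightarrow> complex \<Rightarrow> complex" where
  "osc \<sigma> t k z = z powr (- Complex \<sigma> t) * (z + of_nat k) powr (- cnj (Complex \<sigma> t))"

text \<open>
  The factor \<open>\<i> / (t * k) * z * (z + k)\<close> is the reciprocal of the logarithmic derivative of the
  oscillating part of \<open>osc\<close>; the factor in parentheses cancels the error of next order.
\<close>

definition osc_prim :: "real \<Rightarrow> real \<Rightarrow> nat \<Rightarrow> complex \<Rightarrow> complex" where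
  "osc_prim \<sigma> t k z =
     \<i> / of_real (t * k) * z * (z + of_nat k) *
     (1 - \<i> * of_real (1 - \<sigma>) * (2 * z + of_nat k) / of_real (t * k)) * osc \<sigma> t k z"

text \<open>Mean value inequality along a real segment, viewed as a convex subset of the complex
  plane. It turns derivative bounds into bounds for unit increments.\<close>

lemma norm_diff_le_of_real_derivative_bound:
  fixes f :: "complex \<Rightarrow> complex" and f' :: "real \<Rightarrow> complex"
  assumes "a \<le> b"
    and "\<And>x. a \<le> x \<Longrightarrow> x \<le> b \<Longrightarrow> (f has_field_derivative f' x) (at (of_real x))"
    and "\<And>x. a \<le> x \<Longrightarrow> x \<le> b \<Longrightarrow> norm (f' x) \<le> B"
  shows "norm (f (of_real b) - f (of_real a)) \<le> B * (b - a)"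
proof -
  have "norm (f (of_real b) - f (of_real a)) \<le> B * norm (complex_of_real b - of_real a)"
  proof (rule field_differentiable_bound[where S = "of_real ` {a..b}" and f' = "\<lambda>z. f' (Re z)"])
    show "convex (complex_of_real ` {a..b})"
      by (rule convex_linear_image) (auto intro!: bounded_linear.linear bounded_linear_of_real)
  qed (use assms in \<open>auto intro: has_field_derivative_at_within\<close>)
  also have "norm (complex_of_real b - of_real a) = b - a"
    using assms(1) by (metis abs_of_nonneg diff_ge_0_iff_ge norm_of_real of_real_diff)
  finally show ?thesis .
qed

lemma osc_has_field_derivative:
  assumes "x > 0"
  shows "(osc \<sigma> t k has_field_derivative
           osc \<sigma> t k (of_real x) *
           (- Complex \<sigma> t / of_real x - cnj (Complex \<sigma> t) / of_real (x + k))) (at (of_real x))"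
proof -
  have powr: "((\<lambda>z. z powr c) has_field_derivative of_real y powr c * (c / of_real y)) (at (of_real y))"
    if "y > 0" for y :: real and c :: complex
  proof -
    have "complex_of_real y \<notin> \<real>\<^sub>\<le>\<^sub>0"
      using that by (auto simp: complex_nonpos_Reals_iff)
    from has_field_derivative_powr[OF this, of c] show ?thesis
      using that by (simp add: powr_diff mult.commute)
  qed
  have "((\<lambda>z. (z + of_nat k) powr (- cnj (Complex \<sigma> t))) has_field_derivative
      of_real (x + k) powr (- cnj (Complex \<sigma> t)) * (- cnj (Complex \<sigma> t) / of_real (x + k))) (at (of_real x))"
    using powr[of "x + k" "- cnj (Complex \<sigma> t)"] assms
    by (subst DERIV_shift[symmetric]) simp
  from DERIV_mult[OF powr[OF assms, of "- Complex \<sigma> t"] this] show ?thesis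
    unfolding osc_def by (rule DERIV_cong) (simp add: algebra_simps)
qed

text \<open>Product rule with the logarithmic derivative \<open>L\<close> of \<open>osc\<close>. The
  correcting factor in \<open>osc_prim\<close> removes all terms linear in
  \<open>1 / (t * k)\<close>, so that only a quadratic relative error is left.\<close>

lemma osc_prim_has_field_derivative:
  assumes "x > 0" "t > 0" "k > 0"
  shows "(osc_prim \<sigma> t k has_field_derivative
           osc \<sigma> t k (of_real x) *
           (1 + of_real (((1 - \<sigma>) * (2 * x + k) / (t * k))\<^sup>2
                          + 2 * (1 - \<sigma>) * x * (x + k) / (t * k)\<^sup>2))) (at (of_real x))"
proof -
  define X K c d where "X = complex_of_real x" and "K = complex_of_nat k"
    and "c = \<i> / complex_of_real (t * k)" and "d = c * of_real (1 - \<sigma>)"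
  define L where "L = - Complex \<sigma> t / X - cnj (Complex \<sigma> t) / (X + K)"
  have nz: "X \<noteq> 0" "X + K \<noteq> 0" "complex_of_real t \<noteq> 0" "K \<noteq> 0"
    using assms by (auto simp: complex_eq_iff X_def K_def)
  have c2: "c\<^sup>2 = - 1 / of_real ((t * k)\<^sup>2)"
    by (simp add: c_def power_divide)
  \<comment> \<open>The phase part of \<open>L\<close> becomes exactly 1; the remainder with
    \<sigma> comes from the moduli of the two powers.\<close>
  have cL: "c * (X * (X + K)) * L = 1 - c * of_real \<sigma> * (2 * X + K)"
  proof -
    have "X * (X + K) * L = - (Complex \<sigma> t * (X + K)) - cnj (Complex \<sigma> t) * X"
      using nz by (simp add: L_def right_diff_distrib)
    also have "\<dots> = - of_real \<sigma> * (2 * X + K) - \<i> * of_real t * K"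
      by (simp add: complex_eq_iff X_def K_def algebra_simps)
    finally show ?thesis
      using nz by (simp add: c_def K_def mult.assoc right_diff_distrib diff_divide_distrib)
  qed
  have prim: "osc_prim \<sigma> t k = (\<lambda>z. c * (z * (z + K)) * (1 - d * (2 * z + K)) * osc \<sigma> t k z)"
    by (simp add: fun_eq_iff osc_prim_def c_def d_def K_def)
  have P: "((\<lambda>z. c * (z * (z + K)) * (1 - d * (2 * z + K))) has_field_derivative
          c * (2 * X + K) * (1 - d * (2 * X + K)) - 2 * c * d * (X * (X + K))) (at X)"
    by (auto intro!: derivative_eq_intros simp: algebra_simps)
  have g: "(osc \<sigma> t k has_field_derivative osc \<sigma> t k X * L) (at X)"
    using osc_has_field_derivative[OF assms(1), of \<sigma> t k] by (simp add: X_def K_def L_def)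
  \<comment> \<open>The coefficients of \<open>2 * X + K\<close> linear in \<open>c\<close> are
    \<open>c\<close>, \<open>- c * \<sigma>\<close> and \<open>- d\<close>; they add up to 0 because
    \<open>d = c * (1 - \<sigma>)\<close>.\<close>
  have "c * (2 * X + K) * (1 - d * (2 * X + K)) - 2 * c * d * (X * (X + K))
          + (c * (X * (X + K)) * L) * (1 - d * (2 * X + K))
        = 1 - c\<^sup>2 * ((of_real (1 - \<sigma>) * (2 * X + K))\<^sup>2 + 2 * of_real (1 - \<sigma>) * X * (X + K))"
    unfolding cL d_def by (simp add: power2_eq_square algebra_simps)
  also have "\<dots> = 1 + of_real (((1 - \<sigma>) * (2 * x + k) / (t * k))\<^sup>2
                          + 2 * (1 - \<sigma>) * x * (x + k) / (t * k)\<^sup>2)"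
    unfolding c2 by (simp add: X_def K_def power_divide power_mult_distrib add_divide_distrib)
  finally have eq: "c * (2 * X + K) * (1 - d * (2 * X + K)) - 2 * c * d * (X * (X + K))
          + (c * (X * (X + K)) * L) * (1 - d * (2 * X + K))
        = 1 + of_real (((1 - \<sigma>) * (2 * x + k) / (t * k))\<^sup>2
                          + 2 * (1 - \<sigma>) * x * (x + k) / (t * k)\<^sup>2)" .
  show ?thesis
    unfolding prim X_def[symmetric] eq[symmetric]
    by (rule DERIV_cong[OF DERIV_mult[OF P g]]) (simp add: algebra_simps)
qed

section \<open>Size and unit-step variation of the summand and the antiderivative\<close>

lemma norm_osc_le:
  assumes "x > 0" "\<sigma> \<ge> 0"
  shows "norm (osc \<sigma> t k (of_real x)) \<le> x powr (- 2 * \<sigma>)"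
proof -
  have "norm (osc \<sigma> t k (of_real x)) = x powr (-\<sigma>) * (x + k) powr (-\<sigma>)"
    using assms norm_powr_real_powr[of "of_real x" "- Complex \<sigma> t"]
      norm_powr_real_powr[of "of_real (x + k)" "- cnj (Complex \<sigma> t)"]
    by (simp add: osc_def norm_mult)
  also have "\<dots> \<le> x powr (-\<sigma>) * x powr (-\<sigma>)"
    using assms by (intro mult_left_mono powr_mono2') auto
  also have "\<dots> = x powr (- 2 * \<sigma>)"
    by (simp flip: powr_add)
  finally show ?thesis .
qed

text \<open>The phases of the two powers nearly cancel: the logarithmic derivative has real part at
  most \<open>1 / y\<close> in size (as \<sigma> is at most 1/2) and imaginary part of size
  \<open>t * k / (y * (y + k))\<close>.\<close>

lemma norm_osc_diff_le:
  assumes "m > 0" "m \<le> x" "x \<le> m + 1" "0 < \<sigma>" "\<sigma> \<le> 1/2" "t > 0"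
  shows "norm (osc \<sigma> t k (of_real x) - osc \<sigma> t k (of_real m))
          \<le> m powr (- 2 * \<sigma>) * (1 / m + t * k / m\<^sup>2)"
proof -
  let ?B = "m powr (- 2 * \<sigma>) * (1 / m + t * k / m\<^sup>2)"
  let ?L = "\<lambda>y. - Complex \<sigma> t / complex_of_real y - cnj (Complex \<sigma> t) / complex_of_real (y + k)"
  have "norm (osc \<sigma> t k (of_real x) - osc \<sigma> t k (of_real m)) \<le> ?B * (x - m)"
  proof (rule norm_diff_le_of_real_derivative_bound)
    fix y assume y: "m \<le> y" "y \<le> x"
    show "(osc \<sigma> t k has_field_derivative osc \<sigma> t k (of_real y) * ?L y) (at (of_real y))"
      using y assms by (intro osc_has_field_derivative) auto
    have L: "?L y = - of_real (\<sigma> / y + \<sigma> / (y + k)) - \<i> * of_real (t / y - t / (y + k))"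
      using assms y by (simp add: complex_eq_iff Re_divide_of_real Im_divide_of_real)
    have N: "norm (?L y) \<le> \<bar>\<sigma> / y + \<sigma> / (y + k)\<bar> + \<bar>t / y - t / (y + k)\<bar>"
      unfolding L by (rule order.trans[OF norm_triangle_ineq4]) (simp add: norm_mult del: of_real_add of_real_diff of_real_divide)
    have "\<sigma> / (y + k) \<le> \<sigma> / y"
      using assms y by (intro divide_left_mono) auto
    moreover have "\<sigma> / y \<le> (1/2) / y" "0 \<le> \<sigma> / y" "0 \<le> \<sigma> / (y + k)"
      using assms y by (intro divide_right_mono divide_nonneg_nonneg; simp)+
    ultimately have bnd: "\<bar>\<sigma> / y + \<sigma> / (y + k)\<bar> \<le> 1 / y"
      by (simp only: abs_of_nonneg add_nonneg_nonneg)
    note N also note bnd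
    also have "t / y - t / (y + k) = t * k / (y * (y + k))"
      using assms y by (simp add: field_simps)
    also have "\<bar>t * k / (y * (y + k))\<bar> = t * k / (y * (y + k))"
      using assms y by simp
    also have "1 / y \<le> 1 / m"
      using assms y by (intro divide_left_mono) auto
    also have "t * k / (y * (y + k)) \<le> t * k / m\<^sup>2"
      unfolding power2_eq_square using assms y
      by (intro divide_left_mono mult_mono mult_pos_pos) auto
    finally have L_le: "norm (?L y) \<le> 1 / m + t * k / m\<^sup>2" by simp
    have "norm (osc \<sigma> t k (of_real y)) \<le> y powr (- 2 * \<sigma>)"
      using assms y by (intro norm_osc_le) auto
    also have "\<dots> \<le> m powr (- 2 * \<sigma>)"
      using assms y by (intro powr_mono2') auto
    finally show "norm (osc \<sigma> t k (of_real y) * ?L y) \<le> ?B"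
      using L_le unfolding norm_mult by (intro mult_mono) auto
  qed (use assms in auto)
  also have "\<dots> \<le> ?B * 1"
    using assms by (intro mult_left_mono) auto
  finally show ?thesis by simp
qed

text \<open>The first error term is the relative error of the antiderivative, the second the cost of
  freezing \<open>osc\<close> at the left end of the unit interval.\<close>

lemma osc_prim_step:
  assumes "1 \<le> k" "k \<le> m" "0 < \<sigma>" "\<sigma> \<le> 1/2" "t > 0"
  shows "norm (osc_prim \<sigma> t k (of_nat (Suc m)) - osc_prim \<sigma> t k (of_nat m) - osc \<sigma> t k (of_nat m))
          \<le> 52 * real m powr (2 - 2 * \<sigma>) / (t * k)\<^sup>2
              + real m powr (- 2 * \<sigma>) * (1 / m + t * k / (real m)\<^sup>2)"
proof -
  let ?g = "osc \<sigma> t k"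
  let ?R = "\<lambda>x::real. ((1 - \<sigma>) * (2 * x + k) / (t * k))\<^sup>2 + 2 * (1 - \<sigma>) * x * (x + k) / (t * k)\<^sup>2"
  let ?B = "52 * real m powr (2 - 2 * \<sigma>) / (t * k)\<^sup>2
              + real m powr (- 2 * \<sigma>) * (1 / m + t * k / (real m)\<^sup>2)"
  \<comment> \<open>The increment of \<open>?f\<close> over the unit interval is exactly the
    quantity to be bounded, so the mean value inequality applies to it.\<close>
  let ?f = "\<lambda>z. osc_prim \<sigma> t k z - z * ?g (of_nat m)"
  have m: "real m \<ge> 1" "real k \<ge> 1" "real k \<le> real m" using assms by auto
  have "norm (?f (of_real (real m + 1)) - ?f (of_real (real m))) \<le> ?B * (real m + 1 - real m)"
  proof (rule norm_diff_le_of_real_derivative_bound)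
    fix x assume x: "real m \<le> x" "x \<le> real m + 1"
    show "(?f has_field_derivative ?g (of_real x) * (1 + of_real (?R x)) - ?g (of_nat m)) (at (of_real x))"
      using osc_prim_has_field_derivative[of x t k \<sigma>] assms x m
      by (auto intro!: derivative_eq_intros)
    have "((1 - \<sigma>) * (2 * x + k))\<^sup>2 \<le> (1 * (3 * x))\<^sup>2"
      using assms x m by (intro power_mono mult_mono) auto
    moreover have "2 * (1 - \<sigma>) * x * (x + k) \<le> 2 * 1 * x * (2 * x)"
      using assms x m by (intro mult_mono) auto
    \<comment> \<open>13 = 9 + 4 by \<open>k \<le> x\<close>; then
      \<open>x \<le> m + 1 \<le> 2 * m\<close> gives 52 = 13 * 4.\<close>
    ultimately have "((1 - \<sigma>) * (2 * x + k))\<^sup>2 + 2 * (1 - \<sigma>) * x * (x + k) \<le> 13 * x\<^sup>2"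
      by (simp add: power2_eq_square)
    also have "x\<^sup>2 \<le> (2 * real m)\<^sup>2"
      using x m by (intro power_mono) auto
    finally have "((1 - \<sigma>) * (2 * x + k))\<^sup>2 + 2 * (1 - \<sigma>) * x * (x + k) \<le> 52 * (real m)\<^sup>2"
      by simp
    hence R: "?R x \<le> 52 * (real m)\<^sup>2 / (t * k)\<^sup>2"
      unfolding power_divide add_divide_distrib[symmetric] by (intro divide_right_mono) auto
    have "norm (?g (of_real x)) \<le> x powr (- 2 * \<sigma>)"
      using assms x m by (intro norm_osc_le) auto
    also have "\<dots> \<le> real m powr (- 2 * \<sigma>)"
      using assms x m by (intro powr_mono2') auto
    finally have g: "norm (?g (of_real x)) \<le> real m powr (- 2 * \<sigma>)" .
    have "?R x \<ge> 0"
      using assms x m by auto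
    hence "norm (?g (of_real x) * of_real (?R x)) = norm (?g (of_real x)) * ?R x"
      unfolding norm_mult norm_of_real by simp
    also have "\<dots> \<le> real m powr (- 2 * \<sigma>) * (52 * (real m)\<^sup>2 / (t * k)\<^sup>2)"
      using g R \<open>?R x \<ge> 0\<close> by (intro mult_mono) auto
    also have "\<dots> = 52 * real m powr (2 - 2 * \<sigma>) / (t * k)\<^sup>2"
      using m by (simp add: powr_diff powr_minus field_simps)
    finally have 1: "norm (?g (of_real x) * of_real (?R x)) \<le> 52 * real m powr (2 - 2 * \<sigma>) / (t * k)\<^sup>2" .
    have 2: "norm (?g (of_real x) - ?g (of_real (real m)))
               \<le> real m powr (- 2 * \<sigma>) * (1 / m + t * k / (real m)\<^sup>2)"
      using assms x m by (intro norm_osc_diff_le) auto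
    have "?g (of_real x) * (1 + of_real (?R x)) - ?g (of_nat m) =
           ?g (of_real x) * of_real (?R x) + (?g (of_real x) - ?g (of_real (real m)))"
      by (simp only: of_real_of_nat_eq ring_distribs) simp
    thus "norm (?g (of_real x) * (1 + of_real (?R x)) - ?g (of_nat m)) \<le> ?B"
      using 1 2 norm_triangle_ineq[of "?g (of_real x) * of_real (?R x)" "?g (of_real x) - ?g (of_real (real m))"]
      by (simp only:)
  qed simp
  thus ?thesis by (simp add: algebra_simps)
qed

text \<open>Both bounds come from \<open>osc_prim = ?A - ?A * \<i> * ?u\<close>, with
  \<open>?A\<close> the first-order antiderivative and \<open>?u \<le> 3 * x / (t * k)\<close>. The
  first serves the lower endpoint; the second allows \<open>?A\<close> to replace
  \<open>osc_prim\<close> at the upper one.\<close>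

lemma norm_osc_prim_le:
  assumes "1 \<le> k" "real k \<le> x" "0 < \<sigma>" "\<sigma> \<le> 1/2" "t > 0"
  shows "norm (osc_prim \<sigma> t k (of_real x)) \<le> 2 * x powr (2 - 2 * \<sigma>) / (t * k) * (1 + 3 * x / (t * k))"
    and "norm (osc_prim \<sigma> t k (of_real x) - \<i> / of_real (t * k) * of_real x * (of_real x + of_nat k) * osc \<sigma> t k (of_real x))
           \<le> 6 * x powr (3 - 2 * \<sigma>) / (t * k)\<^sup>2"
proof -
  let ?A = "\<i> / of_real (t * k) * of_real x * (of_real x + of_nat k) * osc \<sigma> t k (of_real x)"
  let ?u = "(1 - \<sigma>) * (2 * x + k) / (t * k)"
  have x: "x \<ge> 1" "real k \<ge> 1" using assms by auto
  have split: "a * (1 - b) * c = a * c - a * c * b" for a b c :: complex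
    by (simp add: algebra_simps)
  have eq: "osc_prim \<sigma> t k (of_real x) = ?A - ?A * \<i> * of_real ?u"
    unfolding osc_prim_def split by simp
  have "norm ?A = 1 / (t * k) * (x * (x + k)) * norm (osc \<sigma> t k (of_real x))"
  proof -
    have "of_real x + of_nat k = complex_of_real (x + k)" by simp
    thus ?thesis
      using assms x by (simp only: norm_mult norm_divide norm_of_real norm_ii) simp
  qed
  also have "\<dots> \<le> 1 / (t * k) * (x * (2 * x)) * x powr (- 2 * \<sigma>)"
    using assms x by (intro mult_mono norm_osc_le) auto
  also have "\<dots> = 2 * x powr (2 - 2 * \<sigma>) / (t * k)"
    using x by (simp add: powr_diff powr_minus field_simps power2_eq_square)
  finally have A: "norm ?A \<le> 2 * x powr (2 - 2 * \<sigma>) / (t * k)" .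
  have u: "0 \<le> ?u" "?u \<le> 3 * x / (t * k)"
  proof -
    have "(1 - \<sigma>) * (2 * x + k) \<le> 1 * (3 * x)"
      using assms x by (intro mult_mono) auto
    thus "?u \<le> 3 * x / (t * k)"
      using assms by (intro divide_right_mono) auto
  qed (use assms x in auto)
  have Au: "norm (?A * \<i> * of_real ?u) = norm ?A * ?u"
    by (simp only: norm_mult norm_of_real norm_ii abs_of_nonneg[OF u(1)] mult_1_right)
  have Au_le: "norm ?A * ?u \<le> 2 * x powr (2 - 2 * \<sigma>) / (t * k) * (3 * x / (t * k))"
    using A u assms x by (intro mult_mono) auto
  show "norm (osc_prim \<sigma> t k (of_real x)) \<le> 2 * x powr (2 - 2 * \<sigma>) / (t * k) * (1 + 3 * x / (t * k))"
    using norm_triangle_ineq4[of ?A "?A * \<i> * of_real ?u"] A Au Au_le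
    unfolding eq distrib_left by linarith
  have "norm (osc_prim \<sigma> t k (of_real x) - ?A) = norm ?A * ?u"
    unfolding eq using Au by (simp only: diff_diff_eq2 norm_minus_cancel add_diff_cancel_left' minus_diff_eq norm_minus_commute)
  also note Au_le
  also have "2 * x powr (2 - 2 * \<sigma>) / (t * k) * (3 * x / (t * k)) = 6 * x powr (3 - 2 * \<sigma>) / (t * k)\<^sup>2"
    using x powr_add[of x 1 "2 - 2 * \<sigma>"] by (simp add: field_simps power2_eq_square)
  finally show "norm (osc_prim \<sigma> t k (of_real x) - ?A) \<le> 6 * x powr (3 - 2 * \<sigma>) / (t * k)\<^sup>2" .
qed

section \<open>Elementary sums and partial summation\<close>

text \<open>Telescoping: \<open>m + 1 \<le> 2 * m\<close> gives
  \<open>1 / m^2 \<le> 2 / m - 2 / (m + 1)\<close>.\<close>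

lemma sum_inverse_square_le:
  assumes "1 \<le> a"
  shows "(\<Sum>m = a..n. 1 / (real m)\<^sup>2) \<le> 2 / real a"
proof (cases "a \<le> Suc n")
  case True
  have "(\<Sum>m = a..n. 1 / (real m)\<^sup>2) \<le> (\<Sum>m = a..n. - 2 / real (Suc m) - - 2 / real m)"
  proof (rule sum_mono)
    fix m assume "m \<in> {a..n}"
    hence m: "real m \<ge> 1" using assms by auto
    hence "2 / (2 * (real m)\<^sup>2) \<le> 2 / (real m * real (Suc m))"
      by (intro divide_left_mono mult_pos_pos) (auto simp: power2_eq_square algebra_simps)
    also have "\<dots> = - 2 / real (Suc m) - - 2 / real m"
      using m by (simp add: field_simps)
    finally show "1 / (real m)\<^sup>2 \<le> - 2 / real (Suc m) - - 2 / real m"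
      by simp
  qed
  also have "\<dots> = - 2 / real (Suc n) - - 2 / real a"
    using True by (rule sum_Suc_diff)
  also have "\<dots> \<le> 2 / real a" by simp
  finally show ?thesis .
qed auto

lemma sum_inverse_le_ln:
  assumes "1 \<le> n"
  shows "(\<Sum>k = 1..n. 1 / real k) \<le> 1 + ln (real n)"
  using assms
proof (induction n rule: dec_induct)
  case (step n)
  have "ln (real n / real (Suc n)) \<le> real n / real (Suc n) - 1"
    using step by (intro ln_le_minus_one) auto
  also have "\<dots> = - 1 / real (Suc n)"
    by (simp add: field_simps)
  finally have "1 / real (Suc n) \<le> ln (real (Suc n)) - ln (real n)"
    using step by (simp add: ln_div)
  with step show ?case by simp
qed simp

text \<open>Partial summation for a nearly geometric sequence of ratio \<open>q\<close>. Multiplying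
  by \<open>q - 1\<close> replaces \<open>w k\<close> by a difference \<open>w (Suc k) - w k\<close>
  up to the step error, whose growth \<open>E * k\<close> is compensated by the weight
  \<open>1 / k\<close>.\<close>

lemma norm_sum_divide_le_of_approx_geometric:
  fixes w :: "nat \<Rightarrow> complex" and W E :: real
  assumes W: "\<And>k. 1 \<le> k \<Longrightarrow> k \<le> Suc n \<Longrightarrow> norm (w k) \<le> W"
    and E: "\<And>k. 1 \<le> k \<Longrightarrow> k \<le> n \<Longrightarrow> norm (w (Suc k) - q * w k) \<le> E * k"
    and q: "q \<noteq> 1"
  shows "norm (\<Sum>k = 1..n. w k / of_nat k) \<le> (4 * W + E * n) / norm (q - 1)"
proof -
  \<comment> \<open>The three sums are a telescoping one, an absolutely convergent one from
    \<open>1 / k - 1 / (k + 1)\<close>, and the step errors; they contribute \<open>2 * W\<close>,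
    \<open>2 * W\<close> and \<open>E * n\<close>.\<close>
  have "(q - 1) * (\<Sum>k = 1..n. w k / of_nat k) =
      (\<Sum>k = 1..n. w (Suc k) / of_nat (Suc k) - w k / of_nat k)
      + (\<Sum>k = 1..n. w (Suc k) / of_nat (k * Suc k)) - (\<Sum>k = 1..n. (w (Suc k) - q * w k) / of_nat k)"
    unfolding sum_distrib_left sum.distrib[symmetric] sum_subtractf[symmetric]
  proof (rule sum.cong)
    fix k assume "k \<in> {1..n}"
    hence "complex_of_nat k \<noteq> 0" by auto
    have "w (Suc k) / of_nat (Suc k) + w (Suc k) / of_nat (k * Suc k) = w (Suc k) / of_nat k"
    proof -
      have "w (Suc k) / of_nat (Suc k) = of_nat k * w (Suc k) / (of_nat k * of_nat (Suc k))"
        using \<open>complex_of_nat k \<noteq> 0\<close> by simp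
      hence "w (Suc k) / of_nat (Suc k) + w (Suc k) / of_nat (k * Suc k) =
              (of_nat k * w (Suc k) + w (Suc k)) / (of_nat k * of_nat (Suc k))"
        by (simp only: of_nat_mult add_divide_distrib)
      also have "of_nat k * w (Suc k) + w (Suc k) = w (Suc k) * of_nat (Suc k)"
        by (simp add: algebra_simps)
      also have "w (Suc k) * of_nat (Suc k) / (of_nat k * of_nat (Suc k)) = w (Suc k) / of_nat k"
        by (rule nonzero_mult_divide_mult_cancel_right) (rule of_nat_neq_0)
      finally show ?thesis .
    qed
    thus "(q - 1) * (w k / of_nat k) = w (Suc k) / of_nat (Suc k) - w k / of_nat k
        + w (Suc k) / of_nat (k * Suc k) - (w (Suc k) - q * w k) / of_nat k"
      by (simp add: algebra_simps diff_divide_distrib)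
  qed simp
  also have "norm \<dots> \<le> 2 * W + 2 * W + E * n"
  proof -
    have W0: "0 \<le> W" using W[of 1] norm_ge_zero[of "w 1"] by linarith
    have "(\<Sum>k = 1..n. w (Suc k) / of_nat (Suc k) - w k / of_nat k) = w (Suc n) / of_nat (Suc n) - w 1"
      by (subst sum_Suc_diff) auto
    moreover have "norm (w (Suc n) / of_nat (Suc n)) \<le> W / 1"
      unfolding norm_divide norm_of_nat using W[of "Suc n"] W0 by (intro frac_le) auto
    moreover have "norm (w 1) \<le> W" using W[of 1] by auto
    ultimately have 1: "norm (\<Sum>k = 1..n. w (Suc k) / of_nat (Suc k) - w k / of_nat k) \<le> 2 * W"
      using norm_triangle_ineq4[of "w (Suc n) / of_nat (Suc n)" "w 1"] by simp
    have "norm (\<Sum>k = 1..n. w (Suc k) / of_nat (k * Suc k)) \<le> (\<Sum>k = 1..n. W * (1 / (real k)\<^sup>2))"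
    proof (rule sum_norm_le)
      fix k assume k: "k \<in> {1..n}"
      have "norm (w (Suc k) / of_nat (k * Suc k)) \<le> W / (real k)\<^sup>2"
        unfolding norm_divide norm_of_nat using W[of "Suc k"] W0 k
        by (intro frac_le) (auto simp: power2_eq_square)
      thus "norm (w (Suc k) / of_nat (k * Suc k)) \<le> W * (1 / (real k)\<^sup>2)" by simp
    qed
    also have "\<dots> \<le> W * 2"
      unfolding sum_distrib_left[symmetric] using W0 sum_inverse_square_le[of 1 n]
      by (intro mult_left_mono) auto
    finally have 2: "norm (\<Sum>k = 1..n. w (Suc k) / of_nat (k * Suc k)) \<le> 2 * W" by simp
    have "norm (\<Sum>k = 1..n. (w (Suc k) - q * w k) / of_nat k) \<le> (\<Sum>k = 1..n. E)"
    proof (rule sum_norm_le)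
      fix k assume k: "k \<in> {1..n}"
      show "norm ((w (Suc k) - q * w k) / of_nat k) \<le> E"
        unfolding norm_divide norm_of_nat using E[of k] k by (simp add: field_simps)
    qed
    hence 3: "norm (\<Sum>k = 1..n. (w (Suc k) - q * w k) / of_nat k) \<le> E * n"
      by (simp add: mult.commute)
    show ?thesis
      using 1 2 3 by (smt (verit) norm_triangle_ineq norm_triangle_ineq4)
  qed
  finally show ?thesis
    using q by (simp add: norm_mult pos_le_divide_eq mult.commute[of "norm (q - 1)"] del: One_nat_def)
qed

section \<open>Cancellation among the upper endpoint terms\<close>

lemma cis_one_neq_one: "cis 1 \<noteq> 1"
  using sin_gt_zero[of 1] pi_gt3 by (auto simp: complex_eq_iff)

text \<open>The range up to \<open>4 * t\<close> covers \<open>N + k\<close> with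
  \<open>N \<le> t + 1\<close> and \<open>k \<le> t + 1\<close>, since
  \<open>2 * t + 2 \<le> 4 * t\<close>.\<close>

lemma norm_of_real_powr_le:
  assumes "1 \<le> t" "0 < \<sigma>" "\<sigma> \<le> 1/2" "0 < y" "y \<le> 4 * t"
  shows "norm (complex_of_real y powr (1 - cnj (Complex \<sigma> t))) \<le> 4 * t powr (1 - \<sigma>)"
proof -
  have "norm (complex_of_real y powr (1 - cnj (Complex \<sigma> t))) = y powr (1 - \<sigma>)"
    using assms by (subst norm_powr_real_powr) auto
  also have "\<dots> \<le> (4 * t) powr (1 - \<sigma>)"
    using assms by (intro powr_mono2) auto
  also have "\<dots> = 4 powr (1 - \<sigma>) * t powr (1 - \<sigma>)"
    using assms by (simp add: powr_mult)
  also have "\<dots> \<le> 4 powr 1 * t powr (1 - \<sigma>)"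
    using assms by (intro mult_right_mono powr_mono) auto
  finally show ?thesis by simp
qed

text \<open>At \<open>y = N + x\<close> the phase of \<open>y powr (\<i> * t)\<close> has derivative
  \<open>t / y\<close>, within \<open>O(k / t)\<close> of 1. A unit step therefore multiplies by
  nearly \<open>cis 1\<close>.\<close>

lemma norm_powr_step_le:
  assumes t: "1 \<le> t" and \<sigma>: "0 < \<sigma>" "\<sigma> \<le> 1/2" and N: "t \<le> N" "N \<le> t + 1"
    and k: "1 \<le> k" "real k \<le> t"
  shows "norm (complex_of_real (N + Suc k) powr (1 - cnj (Complex \<sigma> t))
           - cis 1 * complex_of_real (N + k) powr (1 - cnj (Complex \<sigma> t))) \<le> 16 * t powr (- \<sigma>) * k"
proof -
  define c where "c = 1 - cnj (Complex \<sigma> t)"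
  \<comment> \<open>\<open>F\<close> varies slowly, since \<open>(N + z) powr (\<i> * t)\<close> has phase derivative close to \<open>1\<close>.\<close>
  define F where "F = (\<lambda>z. exp (- \<i> * (z - of_nat (Suc k))) * (of_real N + z) powr c)"
  let ?L = "\<lambda>x. c / of_real (N + x) - \<i>"
  have "norm (F (of_real (real k + 1)) - F (of_real (real k))) \<le> 16 * t powr (- \<sigma>) * k * (real k + 1 - real k)"
  proof (rule norm_diff_le_of_real_derivative_bound)
    fix x assume x: "real k \<le> x" "x \<le> real k + 1"
    have pos: "N + x > 0" using x N t k by linarith
    hence [simp]: "complex_of_real N + of_real x \<notin> \<real>\<^sub>\<le>\<^sub>0" "complex_of_real N + of_real x \<noteq> 0"
      by (auto simp: complex_nonpos_Reals_iff complex_eq_iff)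
    show "(F has_field_derivative F (of_real x) * ?L x) (at (of_real x))"
      unfolding F_def
      by (rule derivative_eq_intros refl | simp)+ (simp add: powr_diff algebra_simps)
    have "norm (F (of_real x)) = norm (of_real (N + x) powr c)"
      by (simp add: F_def norm_mult)
    also have "\<dots> \<le> 4 * t powr (1 - \<sigma>)"
      unfolding c_def using assms x pos by (intro norm_of_real_powr_le) auto
    finally have F: "norm (F (of_real x)) \<le> 4 * t powr (1 - \<sigma>)" .
    have "?L x = of_real ((1 - \<sigma>) / (N + x)) + \<i> * of_real ((t - (N + x)) / (N + x))"
      using pos by (simp add: complex_eq_iff Re_divide_of_real Im_divide_of_real c_def diff_divide_distrib del: of_real_add of_real_divide of_real_diff)
    hence "norm (?L x) \<le> \<bar>(1 - \<sigma>) / (N + x)\<bar> + \<bar>(t - (N + x)) / (N + x)\<bar>"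
      using norm_triangle_ineq[of "of_real ((1 - \<sigma>) / (N + x))" "\<i> * of_real ((t - (N + x)) / (N + x))"]
      by (simp only: norm_mult norm_of_real norm_ii mult_1_left)
    also have "\<dots> = (\<bar>1 - \<sigma>\<bar> + \<bar>t - (N + x)\<bar>) / (N + x)"
      using pos by (simp add: add_divide_distrib)
    \<comment> \<open>The numerator is at most \<open>1 + (1 + k + 1) \<le> 4 * k\<close>, and
      \<open>N + x \<ge> t\<close>.\<close>
    also have "\<dots> \<le> (4 * k) / t"
      using assms x pos by (intro frac_le) auto
    finally have "norm (?L x) \<le> 4 * k / t" .
    hence "norm (F (of_real x) * ?L x) \<le> 4 * t powr (1 - \<sigma>) * (4 * k / t)"
      unfolding norm_mult using F by (intro mult_mono) auto
    also have "\<dots> = 16 * t powr (- \<sigma>) * k"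
      using t by (simp add: powr_diff powr_minus field_simps)
    finally show "norm (F (of_real x) * ?L x) \<le> 16 * t powr (- \<sigma>) * k" .
  qed simp
  also have "F (of_real (real k + 1)) = complex_of_real (N + Suc k) powr c"
    by (simp add: F_def add_ac)
  also have "F (of_real (real k)) = cis 1 * complex_of_real (N + k) powr c"
    by (simp add: F_def cis_conv_exp)
  finally show ?thesis by (simp add: c_def)
qed

text \<open>The first-order part of \<open>osc_prim\<close> at \<open>N\<close> is, apart from a
  factor independent of \<open>k\<close>, a nearly geometric sequence divided by \<open>k\<close>;
  the second-order part is \<open>O(1 / k^2)\<close> and is summed trivially.\<close>

lemma norm_sum_upper_endpoint_le:
  assumes t: "1 \<le> t" and \<sigma>: "0 < \<sigma>" "\<sigma> \<le> 1/2" and N: "t \<le> N" "N \<le> t + 1" and K: "real K \<le> t"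
  shows "norm (\<Sum>k = 1..K. osc_prim \<sigma> t k (of_real N)) \<le> (64 / norm (cis 1 - 1) + 96) * t powr (1 - 2 * \<sigma>)"
proof -
  define w where "w = (\<lambda>k::nat. complex_of_real (N + k) powr (1 - cnj (Complex \<sigma> t)))"
  let ?A = "\<lambda>k. \<i> / of_real (t * k) * of_real N * (of_real N + of_nat k) * osc \<sigma> t k (of_real N)"
  have "norm (\<Sum>k = 1..K. w k / of_nat k) \<le> (4 * (4 * t powr (1 - \<sigma>)) + 16 * t powr (- \<sigma>) * K) / norm (cis 1 - 1)"
  proof (rule norm_sum_divide_le_of_approx_geometric)
    show "norm (w k) \<le> 4 * t powr (1 - \<sigma>)" if "1 \<le> k" "k \<le> Suc K" for k
      unfolding w_def using assms that by (intro norm_of_real_powr_le) auto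
    show "norm (w (Suc k) - cis 1 * w k) \<le> 16 * t powr (- \<sigma>) * k" if "1 \<le> k" "k \<le> K" for k
      unfolding w_def using assms that by (intro norm_powr_step_le) auto
  qed (rule cis_one_neq_one)
  \<comment> \<open>\<open>K \<le> t\<close> keeps the accumulated step errors of the order of the
    main term: 32 = 16 + 16.\<close>
  also have "\<dots> \<le> (4 * (4 * t powr (1 - \<sigma>)) + 16 * t powr (- \<sigma>) * t) / norm (cis 1 - 1)"
    using K by (intro divide_right_mono add_left_mono mult_left_mono) auto
  also have "\<dots> = 32 * t powr (1 - \<sigma>) / norm (cis 1 - 1)"
    using t by (simp add: powr_diff powr_minus field_simps)
  finally have w: "norm (\<Sum>k = 1..K. w k / of_nat k) \<le> 32 * t powr (1 - \<sigma>) / norm (cis 1 - 1)" .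
  have "(\<Sum>k = 1..K. ?A k) = \<i> / of_real t * (of_real N powr (1 - Complex \<sigma> t)) * (\<Sum>k = 1..K. w k / of_nat k)"
    unfolding sum_distrib_left
  proof (rule sum.cong)
    fix k assume "k \<in> {1..K}"
    have nz: "complex_of_real N \<noteq> 0" "complex_of_real (N + k) \<noteq> 0" "complex_of_real N + of_nat k \<noteq> 0"
      using N t by (auto simp: complex_eq_iff)
    have "w k = of_real (N + k) * of_real (N + k) powr (- cnj (Complex \<sigma> t))"
      using nz by (simp add: w_def powr_diff powr_minus field_simps)
    moreover have "of_real N powr (1 - Complex \<sigma> t) = of_real N * of_real N powr (- Complex \<sigma> t)"
      using nz by (simp add: powr_diff powr_minus field_simps)
    ultimately show "?A k = \<i> / of_real t * of_real N powr (1 - Complex \<sigma> t) * (w k / of_nat k)"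
      by (simp add: osc_def)
  qed simp
  also have "norm \<dots> = 1 / t * N powr (1 - \<sigma>) * norm (\<Sum>k = 1..K. w k / of_nat k)"
    using t N by (simp add: norm_mult norm_divide norm_powr_real_powr)
  also have "\<dots> \<le> 1 / t * (2 * t powr (1 - \<sigma>)) * (32 * t powr (1 - \<sigma>) / norm (cis 1 - 1))"
  proof (intro mult_mono w order.refl)
    have "N powr (1 - \<sigma>) \<le> (2 * t) powr (1 - \<sigma>)"
      using assms by (intro powr_mono2) auto
    also have "\<dots> = 2 powr (1 - \<sigma>) * t powr (1 - \<sigma>)"
      using t by (simp add: powr_mult)
    also have "\<dots> \<le> 2 powr 1 * t powr (1 - \<sigma>)"
      using assms by (intro mult_right_mono powr_mono) auto
    finally show "N powr (1 - \<sigma>) \<le> 2 * t powr (1 - \<sigma>)" by simp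
  qed (use t in auto)
  also have "\<dots> = 64 / norm (cis 1 - 1) * (t powr (1 - \<sigma>) * t powr (1 - \<sigma>) / t)"
    by simp
  also have "t powr (1 - \<sigma>) * t powr (1 - \<sigma>) / t = t powr (1 - 2 * \<sigma>)"
    using t powr_add[of t "1 - \<sigma>" "1 - \<sigma>"] powr_add[of t 1 "1 - 2 * \<sigma>"] by (simp add: field_simps)
  finally have A: "norm (\<Sum>k = 1..K. ?A k) \<le> 64 / norm (cis 1 - 1) * t powr (1 - 2 * \<sigma>)" .
  have "norm (\<Sum>k = 1..K. osc_prim \<sigma> t k (of_real N) - ?A k) \<le> (\<Sum>k = 1..K. 48 * t powr (1 - 2 * \<sigma>) * (1 / (real k)\<^sup>2))"
  proof (rule sum_norm_le)
    fix k assume k: "k \<in> {1..K}"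
    have "norm (osc_prim \<sigma> t k (of_real N) - ?A k) \<le> 6 * N powr (3 - 2 * \<sigma>) / (t * k)\<^sup>2"
      using assms k by (intro norm_osc_prim_le) auto
    also have "N powr (3 - 2 * \<sigma>) \<le> (2 * t) powr (3 - 2 * \<sigma>)"
      using assms by (intro powr_mono2) auto
    also have "\<dots> = 2 powr (3 - 2 * \<sigma>) * t powr (3 - 2 * \<sigma>)"
      using t by (simp add: powr_mult)
    also have "\<dots> \<le> 2 powr 3 * t powr (3 - 2 * \<sigma>)"
      using assms by (intro mult_right_mono powr_mono) auto
    \<comment> \<open>48 = 6 * 2^3, from \<open>N \<le> 2 * t\<close>; the sum over \<open>k\<close>
      doubles it to 96.\<close>
    also have "6 * (2 powr 3 * t powr (3 - 2 * \<sigma>)) / (t * k)\<^sup>2 = 48 * t powr (1 - 2 * \<sigma>) * (1 / (real k)\<^sup>2)"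
      using t powr_add[of t 2 "1 - 2 * \<sigma>"] by (simp add: power_mult_distrib)
    finally show "norm (osc_prim \<sigma> t k (of_real N) - ?A k) \<le> 48 * t powr (1 - 2 * \<sigma>) * (1 / (real k)\<^sup>2)"
      by (simp add: divide_right_mono)
  qed
  also have "\<dots> \<le> 48 * t powr (1 - 2 * \<sigma>) * 2"
    unfolding sum_distrib_left[symmetric] using sum_inverse_square_le[of 1 K]
    by (intro mult_left_mono) auto
  finally have "norm ((\<Sum>k = 1..K. osc_prim \<sigma> t k (of_real N)) - (\<Sum>k = 1..K. ?A k)) \<le> 96 * t powr (1 - 2 * \<sigma>)"
    by (simp add: sum_subtractf)
  with A norm_triangle_sub[of "\<Sum>k = 1..K. osc_prim \<sigma> t k (of_real N)" "\<Sum>k = 1..K. ?A k"]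
  show ?thesis unfolding distrib_right by linarith
qed

section \<open>Fixed \<open>k\<close>: the lower endpoint and the errors inside the range\<close>

text \<open>Summing the unit steps telescopes. The three terms of the bound are the lower endpoint
  near \<open>k * T\<close>, the relative error of the antiderivative over at most \<open>t\<close>
  steps, and the cost of freezing \<open>osc\<close> on unit intervals.\<close>

lemma norm_sum_osc_sub_upper_endpoint_le:
  assumes T: "1 \<le> T" "T \<le> t" and \<sigma>: "0 < \<sigma>" "\<sigma> \<le> 1/2" and k: "1 \<le> k"
    and n: "real k * T \<le> real n" "real n \<le> t"
  shows "norm ((\<Sum>m = nat \<lceil>real k * T\<rceil>..n. osc \<sigma> t k (of_nat m)) - osc_prim \<sigma> t k (of_nat (Suc n)))
          \<le> t powr (1 - 2 * \<sigma>) * (56 * (T / t) + 52 * (1 / (real k)\<^sup>2) + 4 * (t / T\<^sup>2) * (1 / real k))"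
proof -
  define a where "a = nat \<lceil>real k * T\<rceil>"
  define P where "P = t powr (1 - 2 * \<sigma>)"
  let ?H = "osc_prim \<sigma> t k"
  let ?g = "osc \<sigma> t k"
  have k1: "real k \<ge> 1" and t: "t > 0" using k T by auto
  have kT: "real k * T \<ge> 1" "real k \<le> real k * T"
    using mult_mono[of 1 "real k" 1 T] mult_left_mono[of 1 T "real k"] T k1 by auto
  have a_ge: "real a \<ge> real k * T" unfolding a_def by linarith
  have a_le: "real a \<le> 2 * (real k * T)" using kT unfolding a_def by linarith
  have a1: "1 \<le> a" using a_ge kT by linarith
  have a_n: "a \<le> Suc n" using n unfolding a_def by linarith
  have "(\<Sum>m = a..n. ?g (of_nat m)) - ?H (of_nat (Suc n)) =
      - (\<Sum>m = a..n. ?H (of_nat (Suc m)) - ?H (of_nat m) - ?g (of_nat m)) - ?H (of_nat a)"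
    using sum_Suc_diff[OF a_n, of "\<lambda>m. ?H (of_nat m)"] by (simp add: sum_subtractf sum.distrib algebra_simps)
  also have "norm \<dots> \<le> norm (\<Sum>m = a..n. ?H (of_nat (Suc m)) - ?H (of_nat m) - ?g (of_nat m)) + norm (?H (of_nat a))"
    using norm_triangle_ineq4[of "- (\<Sum>m = a..n. ?H (of_nat (Suc m)) - ?H (of_nat m) - ?g (of_nat m))" "?H (of_nat a)"]
    unfolding norm_minus_cancel .
  also have "norm (\<Sum>m = a..n. ?H (of_nat (Suc m)) - ?H (of_nat m) - ?g (of_nat m))
      \<le> (\<Sum>m = a..n. 52 * P / (t * (real k)\<^sup>2) + 2 * (t / T) * P * (1 / (real m)\<^sup>2))"
  proof (rule sum_norm_le)
    fix m assume m: "m \<in> {a..n}"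
    have m_ge: "real m \<ge> real k * T" using m a_ge by auto
    have m1: "real m \<ge> 1" and mt: "real m \<le> t" and mk: "k \<le> m"
      using m_ge kT m n by auto
    have "norm (?H (of_nat (Suc m)) - ?H (of_nat m) - ?g (of_nat m))
        \<le> 52 * real m powr (2 - 2 * \<sigma>) / (t * k)\<^sup>2
              + real m powr (- 2 * \<sigma>) * (1 / m + t * k / (real m)\<^sup>2)"
      using \<sigma> k t mk by (intro osc_prim_step) auto
    also have "52 * real m powr (2 - 2 * \<sigma>) / (t * k)\<^sup>2 \<le> 52 * t powr (2 - 2 * \<sigma>) / (t * k)\<^sup>2"
      using \<sigma> m1 mt by (intro divide_right_mono mult_left_mono powr_mono2) auto
    also have "\<dots> = 52 * P / (t * (real k)\<^sup>2)"
      using t powr_add[of t 1 "1 - 2 * \<sigma>"] by (simp add: P_def power_mult_distrib power2_eq_square)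
    \<comment> \<open>Since \<open>m \<ge> k * T\<close>, both \<open>1\<close> and
      \<open>t * k / m\<close> are at most \<open>t / T\<close>; and
      \<open>1 - 2 * \<sigma> \<ge> 0\<close> lets \<open>m powr (1 - 2 * \<sigma>)\<close> be
      replaced by \<open>P\<close>.\<close>
    also have "real m powr (- 2 * \<sigma>) * (1 / m + t * k / (real m)\<^sup>2) \<le> P / m * (2 * (t / T) / m)"
    proof (intro mult_mono)
      have "real m powr (- 2 * \<sigma>) = real m powr (1 - 2 * \<sigma>) / m"
        using m1 powr_add[of "real m" 1 "- 2 * \<sigma>"] by simp
      also have "\<dots> \<le> P / m"
        unfolding P_def using m1 mt \<sigma> by (intro divide_right_mono powr_mono2) auto
      finally show "real m powr (- 2 * \<sigma>) \<le> P / m" .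
      have "1 \<le> t / T" using T by simp
      moreover have "t * k / m \<le> t / T"
        using m_ge T t m1 by (simp add: field_simps)
      ultimately have "(1 + t * k / m) / m \<le> (2 * (t / T)) / m"
        using m1 by (intro divide_right_mono) auto
      thus "1 / m + t * k / (real m)\<^sup>2 \<le> 2 * (t / T) / m"
        by (simp add: add_divide_distrib power2_eq_square)
    qed (use m1 t in \<open>auto simp: P_def\<close>)
    also have "P / m * (2 * (t / T) / m) = 2 * (t / T) * P * (1 / (real m)\<^sup>2)"
      by (simp add: power2_eq_square mult_ac)
    finally show "norm (?H (of_nat (Suc m)) - ?H (of_nat m) - ?g (of_nat m))
        \<le> 52 * P / (t * (real k)\<^sup>2) + 2 * (t / T) * P * (1 / (real m)\<^sup>2)"
      by simp
  qed
  also have "\<dots> = real (Suc n - a) * (52 * P / (t * (real k)\<^sup>2)) + 2 * (t / T) * P * (\<Sum>m = a..n. 1 / (real m)\<^sup>2)"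
    unfolding sum.distrib sum_distrib_left[symmetric] by simp
  also have "\<dots> \<le> t * (52 * P / (t * (real k)\<^sup>2)) + 2 * (t / T) * P * (2 / (real k * T))"
  proof (intro add_mono mult_left_mono mult_right_mono)
    have "(\<Sum>m = a..n. 1 / (real m)\<^sup>2) \<le> 2 / real a" by (rule sum_inverse_square_le[OF a1])
    also have "\<dots> \<le> 2 / (real k * T)" using a_ge kT by (intro divide_left_mono) auto
    finally show "(\<Sum>m = a..n. 1 / (real m)\<^sup>2) \<le> 2 / (real k * T)" .
    show "real (Suc n - a) \<le> t" using a1 n by linarith
  qed (use t T in \<open>auto simp: P_def\<close>)
  also have "\<dots> = P * (52 * (1 / (real k)\<^sup>2) + 4 * (t / T\<^sup>2) * (1 / real k))"
    using t by (simp add: power2_eq_square algebra_simps)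
  \<comment> \<open>Rounding up at most doubles \<open>k * T \<ge> 1\<close>, so
    \<open>a powr (2 - 2 * \<sigma>)\<close> is at most \<open>4 * k * T * P\<close> and the bracket
    at most 7: 56 = 2 * 4 * 7.\<close>
  also have "norm (?H (of_nat a)) \<le> P * (56 * (T / t))"
  proof -
    have "norm (?H (of_real (real a))) \<le> 2 * real a powr (2 - 2 * \<sigma>) / (t * k) * (1 + 3 * real a / (t * k))"
      using \<sigma> k t order.trans[OF kT(2) a_ge] by (intro norm_osc_prim_le) auto
    also have "\<dots> \<le> 2 * (4 * (real k * T * P)) / (t * k) * (1 + 6)"
    proof -
      have "real a powr (2 - 2 * \<sigma>) \<le> (2 * (real k * T)) powr (2 - 2 * \<sigma>)"
        using \<sigma> a_le by (intro powr_mono2) auto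
      also have "\<dots> = 2 powr (2 - 2 * \<sigma>) * (real k * T) powr (2 - 2 * \<sigma>)"
        by (rule powr_mult)
      also have "\<dots> \<le> 2 powr 2 * (real k * T * P)"
      proof (rule mult_mono)
        have "y powr (2 - 2 * \<sigma>) = y * y powr (1 - 2 * \<sigma>)" if "1 \<le> y" for y :: real
          using that powr_add[of y 1 "1 - 2 * \<sigma>"] by simp
        from this[OF kT(1)]
        have "(real k * T) powr (2 - 2 * \<sigma>) = real k * T * (real k * T) powr (1 - 2 * \<sigma>)" .
        also have "\<dots> \<le> real k * T * P"
          unfolding P_def using kT \<sigma> n by (intro mult_left_mono powr_mono2) auto
        finally show "(real k * T) powr (2 - 2 * \<sigma>) \<le> real k * T * P" .
        show "2 powr (2 - 2 * \<sigma>) \<le> (2 powr 2 :: real)"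
          using \<sigma> by (intro powr_mono) auto
      qed auto
      finally have "2 * real a powr (2 - 2 * \<sigma>) \<le> 2 * (4 * (real k * T * P))"
        by (simp add: mult_ac)
      moreover have "real k * T \<le> real k * t"
        using T by (intro mult_left_mono) auto
      hence "3 * real a \<le> 6 * (t * k)"
        using a_le by (simp add: mult.commute)
      hence "1 + 3 * real a / (t * k) \<le> 1 + 6"
        using t k1 by (simp add: pos_divide_le_eq)
      moreover have "0 < t * k" "0 \<le> real k * T * P" "0 \<le> 1 + 3 * real a / (t * k)"
        using t k1 T by (simp_all add: P_def)
      ultimately show ?thesis
        by (intro mult_mono divide_right_mono divide_nonneg_nonneg) (auto simp: mult_ac)
    qed
    also have "\<dots> = P * (56 * (T / t))"
      using k1 t by (simp add: field_simps)
    finally show ?thesis by (simp only: of_real_of_nat_eq)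
  qed
  finally show ?thesis
    unfolding a_def[symmetric] P_def[symmetric] by (simp only: distrib_left add_ac)
qed

section \<open>Exchange of the summations\<close>

lemma le_nat_floor_divide_iff:
  fixes T :: real
  assumes "0 < T"
  shows "k \<le> nat \<lfloor>real m / T\<rfloor> \<longleftrightarrow> real k * T \<le> real m"
  using assms by (simp add: le_nat_iff le_floor_iff pos_le_divide_eq)

lemma S2_eq_sum_osc:
  assumes "0 < t" and T: "1 \<le> t powr (1 - \<delta>)"
  shows "S2 \<sigma> t \<delta> = (\<Sum>k = 1..nat \<lfloor>real (nat \<lfloor>t\<rfloor>) / t powr (1 - \<delta>)\<rfloor>.
           \<Sum>m = nat \<lceil>real k * t powr (1 - \<delta>)\<rceil>..nat \<lfloor>t\<rfloor>. osc \<sigma> t k (of_nat m))"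
proof -
  define T n where "T = t powr (1 - \<delta>)" and "n = nat \<lfloor>t\<rfloor>"
  define K where "K = nat \<lfloor>real n / T\<rfloor>"
  have T1: "T \<ge> 1" using T by (simp add: T_def)
  have floor_le: "k \<le> nat \<lfloor>real m / T\<rfloor> \<longleftrightarrow> real k * T \<le> real m" for k m :: nat
    using T1 by (intro le_nat_floor_divide_iff) auto
  have "S2 \<sigma> t \<delta> = (\<Sum>m = nat \<lfloor>T\<rfloor>..n. \<Sum>k = 1..nat \<lfloor>real m / T\<rfloor>. osc \<sigma> t k (of_nat m))"
    unfolding S2_def Let_def T_def n_def osc_def
    by (simp add: powr_minus field_simps)
  also have "\<dots> = (\<Sum>m\<in>{nat \<lfloor>T\<rfloor>..n}. \<Sum>k\<in>{k \<in> {1..K}. real k * T \<le> real m}. osc \<sigma> t k (of_nat m))"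
  proof (intro sum.cong refl)
    fix m assume m: "m \<in> {nat \<lfloor>T\<rfloor>..n}"
    \<comment> \<open>The cap \<open>k \<le> K\<close> costs nothing, as \<open>m \<le> n\<close>;
      it makes the inner index set a restriction of a fixed one, so that the sums can be
      swapped.\<close>
    have "real k * T \<le> real n" if "real k * T \<le> real m" for k
      using that m by auto
    thus "{1..nat \<lfloor>real m / T\<rfloor>} = {k \<in> {1..K}. real k * T \<le> real m}"
      unfolding K_def by (auto simp: floor_le)
  qed
  also have "\<dots> = (\<Sum>k\<in>{1..K}. \<Sum>m\<in>{m \<in> {nat \<lfloor>T\<rfloor>..n}. real k * T \<le> real m}. osc \<sigma> t k (of_nat m))"
    by (rule sum.swap_restrict) auto
  also have "\<dots> = (\<Sum>k\<in>{1..K}. \<Sum>m\<in>{nat \<lceil>real k * T\<rceil>..n}. osc \<sigma> t k (of_nat m))"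
  proof (intro sum.cong refl)
    fix k assume "k \<in> {1..K}"
    \<comment> \<open>As \<open>k \<ge> 1\<close>, the condition \<open>k * T \<le> m\<close>
      already implies the original lower limit for \<open>m\<close>.\<close>
    hence "T \<le> real k * T" using T1 by simp
    hence "nat \<lfloor>T\<rfloor> \<le> m" if "real k * T \<le> real m" for m :: nat
      using that T1 by linarith
    moreover have "nat \<lceil>real k * T\<rceil> \<le> m \<longleftrightarrow> real k * T \<le> real m" for m :: nat
      by (simp add: nat_le_iff ceiling_le_iff)
    ultimately show "{m \<in> {nat \<lfloor>T\<rfloor>..n}. real k * T \<le> real m} = {nat \<lceil>real k * T\<rceil>..n}"
      by auto
  qed
  finally show ?thesis by (simp only: T_def n_def K_def)
qed

section \<open>Summation over \<open>k\<close> and the final estimates\<close>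

text \<open>The three errors for fixed \<open>k\<close> are summed over \<open>k \<le> K\<close>
  with \<open>K * T \<le> t\<close>; with the upper endpoints the constant is 260 = 96 + 56 + 104 +
  4.\<close>

lemma norm_S2_le:
  assumes t: "1 \<le> t" and \<delta>: "0 < \<delta>" "\<delta> < 1/2" and \<sigma>: "0 < \<sigma>" "\<sigma> \<le> 1/2"
  shows "norm (S2 \<sigma> t \<delta>)
          \<le> (64 / norm (cis 1 - 1) + 260 + 4 / (1 - 2 * \<delta>)) * t powr (1 - 2 * \<sigma>)"
proof -
  define T n where "T = t powr (1 - \<delta>)" and "n = nat \<lfloor>t\<rfloor>"
  define K where "K = nat \<lfloor>real n / T\<rfloor>"
  define P where "P = t powr (1 - 2 * \<sigma>)"
  have T: "1 \<le> T" "T \<le> t"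
    using t \<delta> powr_mono[of "1 - \<delta>" 1 t] by (auto simp: T_def ge_one_powr_ge_zero)
  have n: "real n \<le> t" "t \<le> real n + 1"
    using t unfolding n_def by linarith+
  have KT: "real k * T \<le> real n" if "k \<le> K" for k
    using that T by (simp add: K_def le_nat_floor_divide_iff)
  have K_le: "real K * T \<le> t" using KT[of K] n by simp
  have K_t: "real K \<le> t"
    using K_le mult_left_mono[OF T(1), of "real K"] by linarith
  let ?S = "\<lambda>k. \<Sum>m = nat \<lceil>real k * T\<rceil>..n. osc \<sigma> t k (of_nat m)"
  let ?H = "\<lambda>k. osc_prim \<sigma> t k (of_nat (Suc n))"
  have "norm (\<Sum>k = 1..K. ?H k) = norm (\<Sum>k = 1..K. osc_prim \<sigma> t k (of_real (real n + 1)))"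
    by (simp add: add.commute)
  also have "\<dots> \<le> (64 / norm (cis 1 - 1) + 96) * P"
    unfolding P_def using t \<sigma> n K_t by (intro norm_sum_upper_endpoint_le) auto
  finally have upper: "norm (\<Sum>k = 1..K. ?H k) \<le> (64 / norm (cis 1 - 1) + 96) * P" .
  have "norm (\<Sum>k = 1..K. ?S k - ?H k)
      \<le> (\<Sum>k = 1..K. P * (56 * (T / t) + 52 * (1 / (real k)\<^sup>2) + 4 * (t / T\<^sup>2) * (1 / real k)))"
    unfolding P_def using T \<sigma> n KT by (intro sum_norm_le norm_sum_osc_sub_upper_endpoint_le) auto
  also have "\<dots> = P * (56 * (real K * T / t) + 52 * (\<Sum>k = 1..K. 1 / (real k)\<^sup>2)
                       + 4 * (t / T\<^sup>2) * (\<Sum>k = 1..K. 1 / real k))"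
    unfolding sum_distrib_left[symmetric] sum.distrib by simp
  also have "\<dots> \<le> P * (56 * 1 + 52 * 2 + 4 * (1 + 1 / (1 - 2 * \<delta>)))"
  proof (intro mult_left_mono add_mono)
    show "real K * T / t \<le> 1" using K_le t by simp
    show "(\<Sum>k = 1..K. 1 / (real k)\<^sup>2) \<le> 2" using sum_inverse_square_le[of 1 K] by simp
    \<comment> \<open>This negative power of \<open>t\<close> absorbs the harmonic sum, by
      \<open>ln t \<le> t powr a / a\<close> with \<open>a = 1 - 2 * \<delta> > 0\<close>.\<close>
    have tT: "t / T\<^sup>2 = t powr - (1 - 2 * \<delta>)"
      using t powr_add[of t "1 - \<delta>" "1 - \<delta>"] powr_add[of t "2 - 2 * \<delta>" "- (1 - 2 * \<delta>)"]
      by (simp add: T_def power2_eq_square field_simps)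
    have "(\<Sum>k = 1..K. 1 / real k) \<le> 1 + ln t"
    proof (cases "K \<ge> 1")
      case True
      have "ln (real K) \<le> ln t" using True K_t t by simp
      with sum_inverse_le_ln[OF True] show ?thesis by linarith
    qed (use t in auto)
    also have "\<dots> \<le> t powr (1 - 2 * \<delta>) * (1 + 1 / (1 - 2 * \<delta>))"
      using ln_powr_bound[of t "1 - 2 * \<delta>"] ge_one_powr_ge_zero[of t "1 - 2 * \<delta>"] t \<delta>
      by (simp add: distrib_left)
    finally have "t / T\<^sup>2 * (\<Sum>k = 1..K. 1 / real k)
        \<le> t / T\<^sup>2 * (t powr (1 - 2 * \<delta>) * (1 + 1 / (1 - 2 * \<delta>)))"
      using t by (intro mult_left_mono) auto
    also have "\<dots> = 1 + 1 / (1 - 2 * \<delta>)"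
      using t unfolding tT powr_minus by simp
    finally show "4 * (t / T\<^sup>2) * (\<Sum>k = 1..K. 1 / real k) \<le> 4 * (1 + 1 / (1 - 2 * \<delta>))"
      by simp
  qed (auto simp: P_def)
  finally have "norm ((\<Sum>k = 1..K. ?S k) - (\<Sum>k = 1..K. ?H k)) \<le> (164 + 4 / (1 - 2 * \<delta>)) * P"
    by (simp add: sum_subtractf algebra_simps)
  moreover have "S2 \<sigma> t \<delta> = (\<Sum>k = 1..K. ?S k)"
    using S2_eq_sum_osc[of t \<delta> \<sigma>] t T unfolding T_def n_def K_def by simp
  ultimately show ?thesis
    using upper norm_triangle_sub[of "\<Sum>k = 1..K. ?S k" "\<Sum>k = 1..K. ?H k"]
    unfolding P_def by (simp add: algebra_simps)
qed

theorem theorem5p3: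
  fixes \<sigma> \<delta> :: real
  assumes "0 < \<delta>" and "\<delta> < 1/2" and "0 < \<sigma>" and "\<sigma> \<le> 1/2"
  shows "(\<sigma> < 1/2 \<longrightarrow>
            (\<exists>E1 E2 :: real \<Rightarrow> complex.
               (\<forall>t>0. S2 \<sigma> t \<delta> = E1 t + E2 t) \<and>
               E1 \<in> O[at_top](\<lambda>t. complex_of_real (t powr (1 - 2 * \<sigma>))) \<and>
               E2 \<in> O[at_top](\<lambda>t. complex_of_real (t powr (\<delta> - 2 * \<sigma>))))) \<and>
         (\<sigma> = 1/2 \<longrightarrow>
            (\<exists>E1 E2 :: real \<Rightarrow> complex.
               (\<forall>t>0. S2 \<sigma> t \<delta> = E1 t + E2 t) \<and>
               E1 \<in> O[at_top](\<lambda>t. complex_of_real (ln t)) \<and>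
               E2 \<in> O[at_top](\<lambda>t. complex_of_real (t powr (\<delta> - 1)))))"
proof -
  let ?C = "64 / norm (cis 1 - 1) + 260 + 4 / (1 - 2 * \<delta>)"
  have "eventually (\<lambda>t. norm (S2 \<sigma> t \<delta>) \<le> ?C * norm (complex_of_real (t powr (1 - 2 * \<sigma>)))) at_top"
    using eventually_ge_at_top[of 1] by eventually_elim (use norm_S2_le assms in auto)
  hence main: "(\<lambda>t. S2 \<sigma> t \<delta>) \<in> O[at_top](\<lambda>t. complex_of_real (t powr (1 - 2 * \<sigma>)))"
    by (rule bigoI)
  \<comment> \<open>Here the exponent is 0, so the bound is constant, and
    \<open>ln t \<ge> 1\<close> for \<open>t \<ge> exp 1\<close>.\<close>
  have "(\<lambda>t. complex_of_real (t powr (1 - 2 * \<sigma>))) \<in> O[at_top](\<lambda>t. complex_of_real (ln t))"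
    if "\<sigma> = 1/2"
  proof (rule bigoI[of _ 1])
    show "eventually (\<lambda>t. norm (complex_of_real (t powr (1 - 2 * \<sigma>))) \<le> 1 * norm (complex_of_real (ln t))) at_top"
      using eventually_ge_at_top[of "exp 1"]
    proof eventually_elim
      case (elim t)
      have "0 < t" using elim exp_gt_zero[of 1] by linarith
      moreover from this elim have "1 \<le> ln t" by (simp add: ln_ge_iff)
      moreover have "1 - 2 * \<sigma> = 0" using that by simp
      ultimately show ?case by simp
    qed
  qed
  with main have "\<sigma> = 1/2 \<Longrightarrow> (\<lambda>t. S2 \<sigma> t \<delta>) \<in> O[at_top](\<lambda>t. complex_of_real (ln t))"
    using landau_o.big_trans by blast
  note half = this
  show ?thesis
  proof (intro conjI impI)
    show "\<exists>E1 E2 :: real \<Rightarrow> complex. (\<forall>t>0. S2 \<sigma> t \<delta> = E1 t + E2 t) \<and>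
        E1 \<in> O[at_top](\<lambda>t. complex_of_real (t powr (1 - 2 * \<sigma>))) \<and>
        E2 \<in> O[at_top](\<lambda>t. complex_of_real (t powr (\<delta> - 2 * \<sigma>)))"
      by (rule exI[of _ "\<lambda>t. S2 \<sigma> t \<delta>"], rule exI[of _ "\<lambda>_. 0"]) (use main in simp)
    assume "\<sigma> = 1/2"
    from half[OF this]
    show "\<exists>E1 E2 :: real \<Rightarrow> complex. (\<forall>t>0. S2 \<sigma> t \<delta> = E1 t + E2 t) \<and>
        E1 \<in> O[at_top](\<lambda>t. complex_of_real (ln t)) \<and>
        E2 \<in> O[at_top](\<lambda>t. complex_of_real (t powr (\<delta> - 1)))"
      by - (rule exI[of _ "\<lambda>t. S2 \<sigma> t \<delta>"], rule exI[of _ "\<lambda>_. 0"], simp)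
  qed
qed

end
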